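(* Let $X$ be a compact Hausdorff $F$-space. Then the space of self-maps $C_k(X,X)$ does not contain non-trivial convergent sequences.
   Context: $C_k(X,X)$ denotes the set of continuous functions $X\to X$ with the compact-open topology, generated by the subbasis of sets $[C,U]=\{f : f(C)\subseteq U\}$ with $C\subseteq X$ compact and $U\subseteq X$ open. A cozero-set in a Tychonoff space $X$ is the complement of a set of the form $g^{-1}(0)$ with $g\colon X\to\mathbb{R}$ continuous. A subspace $Y\subseteq X$ is $C^*$-embedded if every bounded continuous real-valued function on $Y$ extends to a continuous function on $X$. An $F$-space is a Tychonoff space in which each cozero-set is $C^*$-embedded. A convergent sequence is trivial if it is eventually constant, and non-trivial otherwise. *)

theory Defs
  imports "HOL-Analysis.Analysis"
begin

definition cozero_set_in :: "'a topology \<Rightarrow> 'a set \<Rightarrow> bool" where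
  "cozero_set_in X S \<longleftrightarrow>
     (\<exists>g::'a \<Rightarrow> real. continuous_map X euclideanreal g \<and>
        S = topspace X - {x \<in> topspace X. g x = 0})"

definition C_star_embedded_in :: "'a topology \<Rightarrow> 'a set \<Rightarrow> bool" where
  "C_star_embedded_in X Y \<longleftrightarrow>
     Y \<subseteq> topspace X \<and>
     (\<forall>f::'a \<Rightarrow> real. continuous_map (subtopology X Y) euclideanreal f \<and> bounded (f ` Y) \<longrightarrow>
        (\<exists>g. continuous_map X euclideanreal g \<and> (\<forall>y\<in>Y. g y = f y)))"

definition tychonoff_space :: "'a topology \<Rightarrow> bool" where
  "tychonoff_space X \<longleftrightarrow> completely_regular_space X \<and> Hausdorff_space X"

definition F_space :: "'a topology \<Rightarrow> bool" where
  "F_space X \<longleftrightarrow> tychonoff_space X \<and> (\<forall>S. cozero_set_in X S \<longrightarrow> C_star_embedded_in X S)"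

text \<open>
  A continuous map between the spaces is represented by its extensional function, so that
  equality of points of the function space is equality of maps on \<^term>\<open>topspace X\<close>.
\<close>

definition continuous_maps :: "'a topology \<Rightarrow> 'b topology \<Rightarrow> ('a \<Rightarrow> 'b) set" where
  "continuous_maps X Y = {f \<in> extensional (topspace X). continuous_map X Y f}"

definition compact_open_topology :: "'a topology \<Rightarrow> 'b topology \<Rightarrow> ('a \<Rightarrow> 'b) topology" where
  "compact_open_topology X Y =
     topology_generated_by
       {{f \<in> continuous_maps X Y. f ` C \<subseteq> U} | C U. compactin X C \<and> openin Y U}"

lemma topspace_compact_open_topology:
  "topspace (compact_open_topology X Y) = continuous_maps X Y"
proof -
  have "continuous_maps X Y = {f \<in> continuous_maps X Y. f ` {} \<subseteq> topspace Y}"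
    by auto
  then have "continuous_maps X Y \<in>
      {{f \<in> continuous_maps X Y. f ` C \<subseteq> U} | C U. compactin X C \<and> openin Y U}"
    using compactin_empty openin_topspace by blast
  then show ?thesis
    unfolding compact_open_topology_def topology_generated_by_topspace by blast
qed

definition convergent_sequence_in :: "'a topology \<Rightarrow> (nat \<Rightarrow> 'a) \<Rightarrow> bool" where
  "convergent_sequence_in T s \<longleftrightarrow>
     range s \<subseteq> topspace T \<and> (\<exists>l. limitin T s l sequentially)"

definition trivial_sequence :: "(nat \<Rightarrow> 'a) \<Rightarrow> bool" where
  "trivial_sequence s \<longleftrightarrow> (\<exists>c. \<forall>\<^sub>F n in sequentially. s n = c)"

end

theory Submission
  imports Defs
begin

text \<open>
  A convergent sequence \<open>s n \<longlonglongrightarrow> f\<close> of self-maps that is not eventually \<open>f\<close> yields points \<open>x n\<close>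
  at which infinitely many \<open>s n\<close> differ from \<open>f\<close>. Convergence in the compact-open topology
  makes the pairs \<open>y n = f (x n)\<close>, \<open>z n = s n (x n)\<close> \<^emph>\<open>asymptotically close\<close>: if \<open>K\<close> is closed
  and \<open>U \<supseteq> K\<close> is open then \<open>y n \<in> K\<close> forces \<open>z n \<in> U\<close> for all large \<open>n\<close>, because
  \<open>[f\<inverse> K, U]\<close> is a neighbourhood of \<open>f\<close>. So the theorem becomes a statement about points: in a
  compact Hausdorff F-space, asymptotically close sequences eventually coincide
  (\<open>compact_F_space_asymptotically_close_eventually_eq\<close>).

  Suppose that \<open>y n \<noteq> z n\<close> for all \<open>n\<close>. If some subsequence of pairs lies in pairwise
  disjoint open sets \<open>V k\<close>, then there is a continuous \<open>g\<close> with \<open>g = 0\<close> at the \<open>y\<close>'s and \<open>g = 1\<close> at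
  the \<open>z\<close>'s: choose such a function on each of countably many disjoint cozero sets; together they
  form a bounded continuous function on the union, which is again a cozero set, and the F-space
  property extends it to the whole space. The closed set \<open>{g \<le> 0}\<close> inside the open set \<open>{g < 1}\<close>
  then contradicts asymptotic closeness (\<open>thin_pairs_not_asymptotically_close\<close>).

  Disjoint open sets are found greedily, provided that each point of a pair has a neighbourhood
  whose closure is missed by infinitely many of the pairs still available. The only obstruction at
  a point \<open>p\<close> is that, along some subsequence, the pairs have both entries in every neighbourhood
  of \<open>p\<close> from some index on, i.e. that both entries converge to \<open>p\<close>
  (\<open>asymptotically_close_avoid_point\<close>). But a compact Hausdorff F-space has no non-trivial
  convergent sequences (\<open>compact_F_space_limitin_eventually_eq\<close>), so both entries would
  eventually equal \<open>p\<close>, although they are distinct. The absence of convergent sequences of points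
  is proved by the same argument, applied to pairs of distinct terms of one sequence.
\<close>

section \<open>Gluing functions in an F-space\<close>

lemma cozero_set_in_imp_openin: "cozero_set_in X S \<Longrightarrow> openin X S"
proof -
  assume "cozero_set_in X S"
  then obtain g :: "'a \<Rightarrow> real" where g: "continuous_map X euclideanreal g"
    and S: "S = topspace X - {x \<in> topspace X. g x = 0}"
    unfolding cozero_set_in_def by blast
  have "S = {x \<in> topspace X. g x \<in> - {0}}"
    using S by auto
  then show ?thesis
    using openin_continuous_map_preimage[OF g, of "- {0}"] by auto
qed

text \<open>
  The union is the cozero set of the sum of the defining functions, truncated and weighted by
  \<open>2\<^sup>-\<^sup>n\<close> so that the series converges uniformly.
\<close>

lemma cozero_set_in_countable_UN:
  fixes V :: "nat \<Rightarrow> 'a set"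
  assumes "\<And>n. cozero_set_in X (V n)"
  shows "cozero_set_in X (\<Union>n. V n)"
proof -
  have "\<forall>n. \<exists>h::'a \<Rightarrow> real. continuous_map X euclideanreal h \<and>
      V n = topspace X - {x \<in> topspace X. h x = 0}"
    using assms unfolding cozero_set_in_def by blast
  then obtain h :: "nat \<Rightarrow> 'a \<Rightarrow> real" where h: "\<And>n. continuous_map X euclideanreal (h n)"
    and V: "\<And>n. V n = topspace X - {x \<in> topspace X. h n x = 0}"
    by metis
  \<comment> \<open>truncation at 1 gives the summable bound for the Weierstrass test\<close>
  define c where "c n x = (1/2)^n * min 1 \<bar>h n x\<bar>" for n x
  have c_nonneg: "0 \<le> c n x" for n x
    unfolding c_def by simp
  have c_le: "norm (c n x) \<le> (1/2)^n" for n x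
    using mult_left_mono[of "min 1 \<bar>h n x\<bar>" 1 "(1/2)^n"] c_nonneg[of n x]
    unfolding c_def by simp
  have c_pos: "0 < c n x \<longleftrightarrow> h n x \<noteq> 0" for n x
    unfolding c_def by (auto simp: zero_less_mult_iff)
  have c_summable: "summable (\<lambda>n. c n x)" for x
    by (rule summable_comparison_test'[OF _ c_le]) (simp add: summable_geometric)
  have c_cont: "continuous_map X euclideanreal (c n)" for n
    unfolding c_def by (intro continuous_intros h)
  have unif: "uniform_limit (topspace X) (\<lambda>n x. \<Sum>i<n. c i x) (\<lambda>x. \<Sum>i. c i x) sequentially"
    by (rule Weierstrass_m_test[OF c_le]) (simp add: summable_geometric)
  have "continuous_map X (Met_TC.mtopology) (\<lambda>x. \<Sum>i. c i x)"
  proof (rule Met_TC.continuous_map_uniform_limit_alt)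
    show "\<forall>\<^sub>F n in sequentially. continuous_map X Met_TC.mtopology (\<lambda>x. \<Sum>i<n. c i x)"
      using c_cont by (simp add: continuous_map_sum)
    show "\<forall>\<^sub>F n in sequentially. \<forall>x\<in>topspace X. dist (\<Sum>i<n. c i x) (\<Sum>i. c i x) < \<epsilon>"
      if "0 < \<epsilon>" for \<epsilon>
      using uniform_limitD[OF unif that] .
  qed auto
  moreover have "(\<Union>n. V n) = topspace X - {x \<in> topspace X. (\<Sum>i. c i x) = 0}"
    using suminf_eq_zero_iff[OF c_summable c_nonneg] c_pos V
    by (auto simp: less_le c_nonneg)
  ultimately show ?thesis
    unfolding cozero_set_in_def by auto
qed

text \<open>
  Disjointness makes the functions fit together to one bounded continuous function on
  \<open>\<Union>n. V n\<close>, and the \<open>C\<^sup>*\<close>-embedding of this cozero set extends it. All later uses of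
  \<open>C\<^sup>*\<close>-embedding go through this lemma.
\<close>

lemma F_space_glue:
  fixes V :: "nat \<Rightarrow> 'a set" and \<phi> :: "nat \<Rightarrow> 'a \<Rightarrow> real"
  assumes F: "F_space X"
    and V: "\<And>n. cozero_set_in X (V n)" and disj: "disjoint_family V"
    and \<phi>: "\<And>n. continuous_map X euclideanreal (\<phi> n)"
    and bd: "\<And>n x. x \<in> V n \<Longrightarrow> \<bar>\<phi> n x\<bar> \<le> B"
  obtains g where "continuous_map X euclideanreal g" "\<And>n x. x \<in> V n \<Longrightarrow> g x = \<phi> n x"
proof -
  let ?C = "\<Union>n. V n"
  let ?Y = "subtopology X ?C"
  have open_V: "openin X (V n)" for n
    using V cozero_set_in_imp_openin by blast
  have top: "topspace ?Y = ?C"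
    using openin_subset[OF open_V] by auto
  have cont: "continuous_map (subtopology ?Y (V n)) euclideanreal (\<phi> n)" for n
    using \<phi> by (simp add: continuous_map_from_subtopology)
  have open_VY: "openin ?Y (V n)" for n
    unfolding openin_subtopology using open_V by blast
  have eq: "\<phi> i x = \<phi> j x" if "x \<in> topspace ?Y \<inter> V i \<inter> V j" for i j x
    using disj that unfolding disjoint_family_on_def by (cases "i = j") auto
  obtain f where f: "continuous_map ?Y euclideanreal f"
    and f_eq: "\<And>x n. x \<in> topspace ?Y \<inter> V n \<Longrightarrow> f x = \<phi> n x"
  proof (rule pasting_lemma_exists[where X = ?Y and I = UNIV and T = V and Y = euclideanreal and f = \<phi>])
    show "topspace ?Y \<subseteq> (\<Union>n\<in>UNIV. V n)"
      using top by simp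
  qed (use open_VY cont eq in auto)
  have f_eq': "f x = \<phi> n x" if "x \<in> V n" for x n
    using f_eq that top by blast
  have "bounded (f ` ?C)"
    unfolding bounded_iff using f_eq' bd by (intro exI[of _ B]) auto
  moreover have "cozero_set_in X ?C"
    using V by (rule cozero_set_in_countable_UN)
  then have "C_star_embedded_in X ?C"
    using F by (simp add: F_space_def)
  ultimately have "\<exists>g. continuous_map X euclideanreal g \<and> (\<forall>y\<in>?C. g y = f y)"
    using f by (simp add: C_star_embedded_in_def)
  then obtain g where g: "continuous_map X euclideanreal g" "\<And>y. y \<in> ?C \<Longrightarrow> g y = f y"
    by blast
  have "g x = \<phi> n x" if "x \<in> V n" for n x
    using g(2)[of x] f_eq'[of x n] that by auto
  then show ?thesis
    by (rule that[OF g(1)])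
qed

text \<open>
  Normality provides inside each \<open>W n\<close> a cozero set around the \<open>n\<close>th pair, and a function
  that separates the two points of this pair; these local functions can be glued.
\<close>

lemma F_space_separate_pairs:
  fixes y z :: "nat \<Rightarrow> 'a"
  assumes normal: "normal_space X" and F: "F_space X"
    and W: "\<And>n. openin X (W n)" and disj: "disjoint_family W"
    and yW: "\<And>n. y n \<in> W n" and zW: "\<And>n. z n \<in> W n" and ne: "\<And>n. y n \<noteq> z n"
  obtains g where "continuous_map X euclideanreal g" "\<And>n. g (y n) = 0" "\<And>n. g (z n) = (1::real)"
proof -
  have T1: "t1_space X"
    using F by (simp add: F_space_def tychonoff_space_def Hausdorff_imp_t1_space)
  have yt: "y n \<in> topspace X" and zt: "z n \<in> topspace X" for n
    using openin_subset[OF W] yW zW by blast+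
  have "\<exists>h. continuous_map X euclideanreal h \<and> h (y n) = 1 \<and> h (z n) = (1::real) \<and>
      (\<forall>x \<in> topspace X - W n. h x = 0)" for n
  proof -
    have "closedin X {y n, z n}"
      using T1 yt zt by (simp add: t1_space_closedin_finite)
    moreover have "closedin X (topspace X - W n)"
      using W by blast
    moreover have "disjnt {y n, z n} (topspace X - W n)"
      using yW zW by (auto simp: disjnt_def)
    ultimately obtain h :: "'a \<Rightarrow> real" where "continuous_map X euclideanreal h"
      "h ` {y n, z n} \<subseteq> {1}" "h ` (topspace X - W n) \<subseteq> {0}"
      by (rule Urysohn_lemma_alt[OF normal])
    then show ?thesis
      by (intro exI[of _ h]) auto
  qed
  then obtain h :: "nat \<Rightarrow> 'a \<Rightarrow> real" where h: "\<And>n. continuous_map X euclideanreal (h n)"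
    and hy: "\<And>n. h n (y n) = 1" and hz: "\<And>n. h n (z n) = 1"
    and h0: "\<And>n x. x \<in> topspace X - W n \<Longrightarrow> h n x = 0"
    by metis
  have "\<exists>\<phi>. continuous_map X euclideanreal \<phi> \<and> \<phi> ` topspace X \<subseteq> {0..1} \<and>
      \<phi> (y n) = 0 \<and> \<phi> (z n) = (1::real)" for n
  proof -
    have "closedin X {y n}" "closedin X {z n}" "disjnt {y n} {z n}"
      using T1 yt zt ne by (auto simp: t1_space_closedin_finite disjnt_def)
    then obtain \<phi> where "continuous_map X (top_of_set {0..1}) \<phi>" "\<phi> ` {y n} \<subseteq> {0}" "\<phi> ` {z n} \<subseteq> {1::real}"
      using Urysohn_lemma[OF normal, of "{y n}" "{z n}" 0 1] by auto
    then show ?thesis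
      by (intro exI[of _ \<phi>]) (auto simp: continuous_map_in_subtopology)
  qed
  then obtain \<phi> :: "nat \<Rightarrow> 'a \<Rightarrow> real" where \<phi>: "\<And>n. continuous_map X euclideanreal (\<phi> n)"
    and \<phi>_range: "\<And>n. \<phi> n ` topspace X \<subseteq> {0..1}"
    and \<phi>y: "\<And>n. \<phi> n (y n) = 0" and \<phi>z: "\<And>n. \<phi> n (z n) = 1"
    by metis
  define V where "V n = topspace X - {x \<in> topspace X. h n x = 0}" for n
  have VW: "V n \<subseteq> W n" for n
    using h0 unfolding V_def by blast
  have V_disj: "disjoint_family V"
    using disj VW unfolding disjoint_family_on_def by blast
  have V_coz: "cozero_set_in X (V n)" for n
    using h unfolding V_def cozero_set_in_def by blast
  have \<phi>_bound: "\<bar>\<phi> n x\<bar> \<le> 1" if "x \<in> V n" for n x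
    using that \<phi>_range[of n] by (auto simp: V_def image_subset_iff)
  obtain g where g: "continuous_map X euclideanreal g"
    and g\<phi>: "\<And>n x. x \<in> V n \<Longrightarrow> g x = \<phi> n x"
    by (rule F_space_glue[where V = V and \<phi> = \<phi>, OF F V_coz V_disj \<phi> \<phi>_bound]) (assumption, rule that)
  have "y n \<in> V n" "z n \<in> V n" for n
    using yt zt hy hz unfolding V_def by auto
  then have "g (y n) = 0" "g (z n) = 1" for n
    using g\<phi>[of "y n" n] g\<phi>[of "z n" n] \<phi>y \<phi>z by simp_all
  then show ?thesis
    by (rule that[OF g])
qed

section \<open>Thinning out a sequence of pairs\<close>

text \<open>
  Whichever infinitely many indices have been retained, \<open>p\<close> can be separated from infinitely
  many of their pairs. Quantifying over all infinite \<open>S\<close> allows the choice to be iterated.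
\<close>

definition thins_out_at :: "'a topology \<Rightarrow> (nat \<Rightarrow> 'a) \<Rightarrow> (nat \<Rightarrow> 'a) \<Rightarrow> 'a \<Rightarrow> bool" where
  "thins_out_at X y z p \<longleftrightarrow>
     (\<forall>S. infinite S \<longrightarrow> (\<exists>S' W. S' \<subseteq> S \<and> infinite S' \<and> openin X W \<and> p \<in> W \<and>
        (\<forall>m\<in>S'. y m \<notin> X closure_of W \<and> z m \<notin> X closure_of W)))"

lemma thins_out_atE:
  assumes "thins_out_at X y z p" "infinite S"
  obtains S' W where "S' \<subseteq> S" "infinite S'" "openin X W" "p \<in> W"
    "\<And>m. m \<in> S' \<Longrightarrow> y m \<notin> X closure_of W \<and> z m \<notin> X closure_of W"
proof -
  have "\<exists>S' W. S' \<subseteq> S \<and> infinite S' \<and> openin X W \<and> p \<in> W \<and>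
      (\<forall>m\<in>S'. y m \<notin> X closure_of W \<and> z m \<notin> X closure_of W)"
    using assms(1)[unfolded thins_out_at_def, rule_format, OF assms(2)] .
  then show thesis
    by (elim exE conjE) (rule that, auto)
qed

text \<open>
  A greedy choice. With an infinite set of indices at hand, take its least element, pick a
  neighbourhood of that pair, and retain an infinite set of indices whose pairs avoid the closure of
  this neighbourhood. The sets obtained need not be disjoint, but each pair avoids the closures of
  all earlier sets, so these closures can be subtracted afterwards.
\<close>

lemma thin_pairs_subsequence:
  fixes y z :: "nat \<Rightarrow> 'a"
  assumes thin_y: "\<And>n. thins_out_at X y z (y n)" and thin_z: "\<And>n. thins_out_at X y z (z n)"
  obtains r V where "strict_mono (r :: nat \<Rightarrow> nat)" "\<And>k. openin X (V k)" "disjoint_family V"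
    "\<And>k. y (r k) \<in> V k" "\<And>k. z (r k) \<in> V k"
proof -
  have "\<exists>S' W. S' \<subseteq> S \<and> infinite S' \<and> openin X W \<and> y n \<in> W \<and> z n \<in> W \<and>
      (\<forall>m\<in>S'. y m \<notin> X closure_of W \<and> z m \<notin> X closure_of W)" if S: "infinite S" for S n
  proof -
    obtain S1 W1 where 1: "S1 \<subseteq> S" "infinite S1" "openin X W1" "y n \<in> W1"
      "\<And>m. m \<in> S1 \<Longrightarrow> y m \<notin> X closure_of W1 \<and> z m \<notin> X closure_of W1"
      by (rule thins_out_atE[OF thin_y S]) (rule that)
    obtain S2 W2 where 2: "S2 \<subseteq> S1" "infinite S2" "openin X W2" "z n \<in> W2"
      "\<And>m. m \<in> S2 \<Longrightarrow> y m \<notin> X closure_of W2 \<and> z m \<notin> X closure_of W2"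
      by (rule thins_out_atE[OF thin_z 1(2)]) (rule that)
    show ?thesis
      using 1 2 by (intro exI[of _ S2] exI[of _ "W1 \<union> W2"]) (auto simp: closure_of_Un)
  qed
  then obtain F W where FW: "\<And>S n. infinite S \<Longrightarrow> F S n \<subseteq> S \<and> infinite (F S n) \<and> openin X (W S n) \<and>
      y n \<in> W S n \<and> z n \<in> W S n \<and>
      (\<forall>m\<in>F S n. y m \<notin> X closure_of (W S n) \<and> z m \<notin> X closure_of (W S n))"
    by metis
  define S where "S k = ((\<lambda>S. F S (Inf S)) ^^ k) UNIV" for k
  define r where "r k = Inf (S k)" for k
  define O' where "O' k = W (S k) (r k)" for k
  have S_Suc: "S (Suc k) = F (S k) (r k)" for k
    unfolding S_def r_def by simp
  have S_inf: "infinite (S k)" for k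
    by (induction k) (use FW S_Suc in \<open>simp_all add: S_def[of 0]\<close>)
  have step: "S (Suc k) \<subseteq> S k" "openin X (O' k)" "y (r k) \<in> O' k" "z (r k) \<in> O' k"
    "\<And>m. m \<in> S (Suc k) \<Longrightarrow> y m \<notin> X closure_of (O' k) \<and> z m \<notin> X closure_of (O' k)" for k
    using FW[OF S_inf, of k "r k"] unfolding S_Suc O'_def by auto
  have r_in: "r k \<in> S k" for k
    unfolding r_def using S_inf by (metis Inf_nat_def1 finite.emptyI)
  have S_mono: "S k \<subseteq> S j" if "j \<le> k" for j k
    using that step(1) by (rule lift_Suc_antimono_le[rotated])
  have O'_cl: "O' k \<subseteq> X closure_of O' k" for k
    by (simp add: closure_of_subset openin_subset step(2))
  have avoid: "y (r k) \<notin> X closure_of (O' j)" "z (r k) \<notin> X closure_of (O' j)" if "j < k" for j k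
    using step(5)[of "r k" j] r_in[of k] S_mono[of "Suc j" k] that by auto
  have r_mono: "strict_mono r"
    unfolding strict_mono_Suc_iff
  proof
    fix k
    have "r (Suc k) \<in> S k"
      using r_in step(1) by blast
    then have "r k \<le> r (Suc k)"
      unfolding r_def by (simp add: cInf_lower)
    moreover have "r k \<noteq> r (Suc k)"
      using avoid[of k "Suc k"] step(3)[of k] O'_cl[of k] by auto
    ultimately show "r k < r (Suc k)"
      by simp
  qed
  \<comment> \<open>closures are subtracted, rather than the sets themselves, to keep the differences open\<close>
  define V where "V k = O' k - (\<Union>j<k. X closure_of (O' j))" for k
  have "openin X (V k)" for k
    unfolding V_def by (intro openin_diff step(2) closedin_Union) auto
  moreover have "V j \<inter> V k = {}" if "j < k" for j k
    using that O'_cl[of j] unfolding V_def by auto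
  then have "disjoint_family V"
    unfolding disjoint_family_on_def by (metis inf_commute linorder_neqE_nat)
  moreover have "y (r k) \<in> V k" "z (r k) \<in> V k" for k
    using step(3,4) avoid unfolding V_def by auto
  ultimately show ?thesis
    using that r_mono by blast
qed

section \<open>Asymptotically close sequences\<close>

text \<open>
  In a compact Hausdorff space this says that \<open>(y n, z n)\<close> eventually lies in each entourage of the
  unique compatible uniformity; the formulation with a closed set inside an open one is the form
  in which the compact-open topology delivers it.
\<close>

definition asymptotically_close :: "'a topology \<Rightarrow> (nat \<Rightarrow> 'a) \<Rightarrow> (nat \<Rightarrow> 'a) \<Rightarrow> bool" where
  "asymptotically_close X y z \<longleftrightarrow>
     (\<forall>K U. closedin X K \<and> openin X U \<and> K \<subseteq> U \<longrightarrow> (\<forall>\<^sub>F n in sequentially. y n \<in> K \<longrightarrow> z n \<in> U))"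

lemma asymptotically_closeD:
  "asymptotically_close X y z \<Longrightarrow> closedin X K \<Longrightarrow> openin X U \<Longrightarrow> K \<subseteq> U
    \<Longrightarrow> \<forall>\<^sub>F n in sequentially. y n \<in> K \<longrightarrow> z n \<in> U"
  unfolding asymptotically_close_def by blast

text \<open>The contrapositive of the condition for \<open>K \<subseteq> U\<close> is the condition for the complements.\<close>

lemma asymptotically_close_sym:
  assumes close: "asymptotically_close X y z"
    and y: "range y \<subseteq> topspace X" and z: "range z \<subseteq> topspace X"
  shows "asymptotically_close X z y"
  unfolding asymptotically_close_def
proof (intro allI impI)
  fix K U assume KU: "closedin X K \<and> openin X U \<and> K \<subseteq> U"
  then have "\<forall>\<^sub>F n in sequentially. y n \<in> topspace X - U \<longrightarrow> z n \<in> topspace X - K"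
    by (intro asymptotically_closeD[OF close]) auto
  then show "\<forall>\<^sub>F n in sequentially. z n \<in> K \<longrightarrow> y n \<in> U"
    by (rule eventually_mono) (use y in auto)
qed

lemma asymptotically_close_subsequence:
  assumes "asymptotically_close X y z" "strict_mono r"
  shows "asymptotically_close X (y \<circ> r) (z \<circ> r)"
  using assms eventually_subseq unfolding asymptotically_close_def o_def by blast

lemma common_limit_imp_asymptotically_close:
  assumes y: "limitin X y p sequentially" and z: "limitin X z p sequentially"
  shows "asymptotically_close X y z"
  unfolding asymptotically_close_def
proof (intro allI impI)
  fix K U assume KU: "closedin X K \<and> openin X U \<and> K \<subseteq> U"
  show "\<forall>\<^sub>F n in sequentially. y n \<in> K \<longrightarrow> z n \<in> U"
  proof (cases "p \<in> U")
    case True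
    then have "\<forall>\<^sub>F n in sequentially. z n \<in> U"
      using limitinD[OF z] KU by blast
    then show ?thesis
      by (rule eventually_mono) simp
  next
    case False
    then have "\<forall>\<^sub>F n in sequentially. y n \<in> topspace X - K"
      using limitinD[OF y] limitin_topspace[OF y] KU by blast
    then show ?thesis
      by (rule eventually_mono) auto
  qed
qed

lemma thin_pairs_not_asymptotically_close:
  fixes y z :: "nat \<Rightarrow> 'a"
  assumes normal: "normal_space X" and F: "F_space X"
    and y: "range y \<subseteq> topspace X" and ne: "\<And>n. y n \<noteq> z n"
    and thin: "\<And>n. thins_out_at X y z (y n)" "\<And>n. thins_out_at X y z (z n)"
  shows "\<not> asymptotically_close X y z"
proof
  assume close: "asymptotically_close X y z"
  obtain r V where r: "strict_mono (r :: nat \<Rightarrow> nat)" and V: "\<And>k. openin X (V k)" "disjoint_family V"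
    "\<And>k. y (r k) \<in> V k" "\<And>k. z (r k) \<in> V k"
    using thin_pairs_subsequence[OF thin] by blast
  obtain g where g: "continuous_map X euclideanreal g"
    and g0: "\<And>k. g (y (r k)) = 0" and g1: "\<And>k. g (z (r k)) = 1"
    using F_space_separate_pairs[OF normal F V(1,2), of "y \<circ> r" "z \<circ> r"] V(3,4) ne by auto
  have "\<forall>\<^sub>F k in sequentially. (y \<circ> r) k \<in> {x \<in> topspace X. g x \<in> {..0}} \<longrightarrow>
      (z \<circ> r) k \<in> {x \<in> topspace X. g x \<in> {..<1}}"
    by (intro asymptotically_closeD[OF asymptotically_close_subsequence[OF close r]]
        closedin_continuous_map_preimage[OF g] openin_continuous_map_preimage[OF g]) auto
  then have "\<forall>\<^sub>F k in sequentially. False"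
    by (rule eventually_mono) (use y g0 g1 in auto)
  then show False
    by simp
qed

text \<open>
  Pair each term \<open>y k \<noteq> p\<close> of the sequence with a later term \<open>z k\<close> different from it. Both
  sequences converge to \<open>p\<close>, so they are asymptotically close; and since the pairs accumulate at
  \<open>p\<close> only, they thin out at every other point.
\<close>

lemma compact_F_space_limitin_eventually_eq:
  assumes comp: "compact_space X" and haus: "Hausdorff_space X" and F: "F_space X"
    and w: "range w \<subseteq> topspace X" and lim: "limitin X w p sequentially"
  shows "\<forall>\<^sub>F n in sequentially. w n = p"
proof (rule ccontr)
  assume "\<not> (\<forall>\<^sub>F n in sequentially. w n = p)"
  then have "infinite {n. w n \<noteq> p}"
    by (simp add: eventually_cofinite flip: cofinite_eq_sequentially)
  then obtain r :: "nat \<Rightarrow> nat" where r: "strict_mono r" and rp: "\<And>n. w (r n) \<noteq> p"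
    using infinite_enumerate by blast
  define y where "y = w \<circ> r"
  have yp: "y n \<noteq> p" and yt: "y n \<in> topspace X" for n
    using rp w by (auto simp: y_def)
  have y_lim: "limitin X y p sequentially"
    unfolding y_def using limitin_subsequence[OF r lim] .
  have p: "p \<in> topspace X"
    using lim by (rule limitin_topspace)
  have fin_closed: "closedin X A" if "finite A" "A \<subseteq> topspace X" for A
    using that haus Hausdorff_imp_t1_space t1_space_closedin_finite by blast
  have "\<exists>j\<ge>k. y j \<noteq> y k" for k
  proof -
    have "openin X (topspace X - {y k})"
      using fin_closed[of "{y k}"] yt by blast
    then have "\<forall>\<^sub>F n in sequentially. y n \<in> topspace X - {y k}"
      using p yp[of k] by (intro limitinD[OF y_lim]) auto
    then have "\<forall>\<^sub>F n in sequentially. n \<ge> k \<and> y n \<noteq> y k"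
      using eventually_ge_at_top[of k] by eventually_elim auto
    then show ?thesis
      by (auto simp: eventually_sequentially)
  qed
  then obtain j where j: "\<And>k. j k \<ge> k" "\<And>k. y (j k) \<noteq> y k"
    by metis
  define z where "z = y \<circ> j"
  have j_lim: "filterlim j at_top sequentially"
    by (rule filterlim_at_top_mono[OF filterlim_ident]) (simp add: j)
  have z_lim: "limitin X z p sequentially"
    using y_lim eventually_compose_filterlim[OF _ j_lim] unfolding limitin_def z_def o_def by blast
  have "thins_out_at X y z q" if q: "q \<in> topspace X" "q \<noteq> p" for q
    unfolding thins_out_at_def
  proof (intro allI impI)
    fix S :: "nat set"
    assume S: "infinite S"
    obtain U W where UW: "openin X U" "openin X W" "p \<in> U" "q \<in> W" "disjnt U W"
      using haus p q unfolding Hausdorff_space_def by metis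
    have U_cl: "U \<inter> X closure_of W = {}"
      using UW by (simp add: openin_Int_closure_of_eq_empty disjnt_def)
    have "\<forall>\<^sub>F m in sequentially. y m \<in> U \<and> z m \<in> U"
      using limitinD[OF y_lim UW(1,3)] limitinD[OF z_lim UW(1,3)] by (rule eventually_conj)
    then have "finite {m. \<not> (y m \<in> U \<and> z m \<in> U)}"
      by (simp add: eventually_cofinite flip: cofinite_eq_sequentially)
    then have "infinite (S - {m. \<not> (y m \<in> U \<and> z m \<in> U)})"
      using S by simp
    then show "\<exists>S' W. S' \<subseteq> S \<and> infinite S' \<and> openin X W \<and> q \<in> W \<and>
        (\<forall>m\<in>S'. y m \<notin> X closure_of W \<and> z m \<notin> X closure_of W)"
      using UW U_cl by (intro exI[of _ "S - {m. \<not> (y m \<in> U \<and> z m \<in> U)}"] exI[of _ W]) auto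
  qed
  then have "thins_out_at X y z (y n)" "thins_out_at X y z (z n)" for n
    using yt yp unfolding z_def by auto
  moreover have "range y \<subseteq> topspace X" "y n \<noteq> z n" for n
    using yt j(2)[of n] unfolding z_def by auto
  ultimately have "\<not> asymptotically_close X y z"
    by (intro thin_pairs_not_asymptotically_close[OF
          compact_Hausdorff_or_regular_imp_normal_space[OF comp disjI1[OF haus]] F])
  then show False
    using common_limit_imp_asymptotically_close[OF y_lim z_lim] by blast
qed

text \<open>
  Infinitely many pairs have an entry outside \<open>U\<close>. For large \<open>m\<close> such a pair has no entry in a
  closed neighbourhood \<open>K \<subseteq> U\<close> of \<open>p\<close>: an entry in \<open>K\<close> would force the other one into \<open>U\<close>.
\<close>

lemma asymptotically_close_avoid_point:
  assumes reg: "regular_space X" and close: "asymptotically_close X y z"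
    and y: "range y \<subseteq> topspace X" and z: "range z \<subseteq> topspace X"
    and U: "openin X U" "p \<in> U" and inf: "infinite {m \<in> S. \<not> (y m \<in> U \<and> z m \<in> U)}"
  obtains S' W where "S' \<subseteq> S" "infinite S'" "openin X W" "p \<in> W"
    "\<And>m. m \<in> S' \<Longrightarrow> y m \<notin> X closure_of W \<and> z m \<notin> X closure_of W"
proof -
  obtain W K where W: "openin X W" "closedin X K" "p \<in> W" "W \<subseteq> K" "K \<subseteq> U"
    using reg U unfolding neighbourhood_base_of_closedin[symmetric] neighbourhood_base_of by meson
  have "\<forall>\<^sub>F m in sequentially. (y m \<in> K \<longrightarrow> z m \<in> U) \<and> (z m \<in> K \<longrightarrow> y m \<in> U)"
    using asymptotically_closeD[OF close W(2) U(1) W(5)]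
      asymptotically_closeD[OF asymptotically_close_sym[OF close y z] W(2) U(1) W(5)]
    by (rule eventually_conj)
  then have fin: "finite {m. \<not> ((y m \<in> K \<longrightarrow> z m \<in> U) \<and> (z m \<in> K \<longrightarrow> y m \<in> U))}" (is "finite ?E")
    by (simp only: eventually_cofinite flip: cofinite_eq_sequentially)
  have cl: "X closure_of W \<subseteq> K"
    using W by (simp add: closure_of_minimal)
  show ?thesis
  proof (rule that[of "{m \<in> S. \<not> (y m \<in> U \<and> z m \<in> U)} - ?E" W])
    show "infinite ({m \<in> S. \<not> (y m \<in> U \<and> z m \<in> U)} - ?E)"
      using inf fin by simp
  qed (use W cl in auto)
qed

text \<open>
  If the pairs indexed by \<open>S\<close> did not leave some neighbourhood of \<open>p\<close> infinitely often, both of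
  their entries would converge to \<open>p\<close> along \<open>S\<close>, and hence would eventually be equal to \<open>p\<close>.
\<close>

lemma compact_F_space_distinct_not_asymptotically_close:
  assumes comp: "compact_space X" and haus: "Hausdorff_space X" and F: "F_space X"
    and y: "range y \<subseteq> topspace X" and z: "range z \<subseteq> topspace X"
    and ne: "\<And>n. y n \<noteq> z n"
  shows "\<not> asymptotically_close X y z"
proof
  assume close: "asymptotically_close X y z"
  have "thins_out_at X y z p" if p: "p \<in> topspace X" for p
    unfolding thins_out_at_def
  proof (intro allI impI)
    fix S :: "nat set"
    assume S: "infinite S"
    have "\<exists>U. openin X U \<and> p \<in> U \<and> infinite {m \<in> S. \<not> (y m \<in> U \<and> z m \<in> U)}"
    proof (rule ccontr)
      assume no: "\<not> ?thesis"
      obtain r :: "nat \<Rightarrow> nat" where r: "strict_mono r" "\<And>n. r n \<in> S"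
        using infinite_enumerate[OF S] by blast
      have ev: "\<forall>\<^sub>F n in sequentially. y (r n) \<in> U \<and> z (r n) \<in> U" if "openin X U" "p \<in> U" for U
      proof -
        have "finite {m. \<not> (m \<in> S \<longrightarrow> y m \<in> U \<and> z m \<in> U)}"
          using no that by (auto elim: rev_finite_subset)
        then have "\<forall>\<^sub>F m in sequentially. m \<in> S \<longrightarrow> y m \<in> U \<and> z m \<in> U"
          by (simp only: eventually_cofinite flip: cofinite_eq_sequentially)
        from eventually_subseq[OF r(1) this] show ?thesis
          using r(2) by simp
      qed
      have "limitin X (y \<circ> r) p sequentially" "limitin X (z \<circ> r) p sequentially"
        unfolding limitin_def using p ev by (simp_all add: eventually_conj_iff)
      moreover have "range (y \<circ> r) \<subseteq> topspace X" "range (z \<circ> r) \<subseteq> topspace X"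
        using y z by auto
      ultimately have "\<forall>\<^sub>F n in sequentially. (y \<circ> r) n = p" "\<forall>\<^sub>F n in sequentially. (z \<circ> r) n = p"
        using compact_F_space_limitin_eventually_eq[OF comp haus F] by blast+
      then have "\<forall>\<^sub>F n in sequentially. False"
        by eventually_elim (use ne in \<open>metis comp_apply\<close>)
      then show False
        by simp
    qed
    then obtain U where U: "openin X U" "p \<in> U" "infinite {m \<in> S. \<not> (y m \<in> U \<and> z m \<in> U)}"
      by blast
    show "\<exists>S' W. S' \<subseteq> S \<and> infinite S' \<and> openin X W \<and> p \<in> W \<and>
        (\<forall>m\<in>S'. y m \<notin> X closure_of W \<and> z m \<notin> X closure_of W)"
      by (rule asymptotically_close_avoid_point[OF
            compact_Hausdorff_imp_regular_space[OF comp haus] close y z U]) blast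
  qed
  then have "thins_out_at X y z (y n)" "thins_out_at X y z (z n)" for n
    using y z by (simp_all add: image_subset_iff)
  then show False
    using thin_pairs_not_asymptotically_close[OF
        compact_Hausdorff_or_regular_imp_normal_space[OF comp disjI1[OF haus]] F y ne] close
    by blast
qed

lemma compact_F_space_asymptotically_close_eventually_eq:
  assumes comp: "compact_space X" and haus: "Hausdorff_space X" and F: "F_space X"
    and y: "range y \<subseteq> topspace X" and z: "range z \<subseteq> topspace X"
    and close: "asymptotically_close X y z"
  shows "\<forall>\<^sub>F n in sequentially. y n = z n"
proof (rule ccontr)
  assume "\<not> (\<forall>\<^sub>F n in sequentially. y n = z n)"
  then have "infinite {n. y n \<noteq> z n}"
    by (simp add: eventually_cofinite flip: cofinite_eq_sequentially)
  then obtain r :: "nat \<Rightarrow> nat" where r: "strict_mono r" "\<And>n. y (r n) \<noteq> z (r n)"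
    using infinite_enumerate by blast
  then show False
    using compact_F_space_distinct_not_asymptotically_close[OF comp haus F, of "y \<circ> r" "z \<circ> r"]
      asymptotically_close_subsequence[OF close r(1)] y z by (auto simp: image_subset_iff)
qed

section \<open>Sequences of maps\<close>

text \<open>
  For closed \<open>K\<close> inside an open \<open>U\<close>, the set \<open>C = f\<inverse> K\<close> is compact and \<open>f\<close> lies in the subbasic
  open set \<open>[C, U]\<close>. The points \<open>x n\<close> may vary with \<open>n\<close> because membership of \<open>s n\<close> in this set
  constrains all points of \<open>C\<close> at once.
\<close>

lemma compact_open_limit_asymptotically_close:
  assumes comp: "compact_space X"
    and lim: "limitin (compact_open_topology X Y) s f sequentially"
    and x: "range x \<subseteq> topspace X"
  shows "asymptotically_close Y (\<lambda>n. f (x n)) (\<lambda>n. s n (x n))"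
  unfolding asymptotically_close_def
proof (intro allI impI)
  fix K U assume KU: "closedin Y K \<and> openin Y U \<and> K \<subseteq> U"
  have f: "f \<in> continuous_maps X Y"
    using limitin_topspace[OF lim] by (simp add: topspace_compact_open_topology)
  define C where "C = {a \<in> topspace X. f a \<in> K}"
  define N where "N = {g \<in> continuous_maps X Y. g ` C \<subseteq> U}"
  have "compactin X C"
    unfolding C_def using comp f KU
    by (intro closedin_compact_space closedin_continuous_map_preimage) (auto simp: continuous_maps_def)
  then have "openin (compact_open_topology X Y) N"
    unfolding compact_open_topology_def N_def using KU by (intro topology_generated_by_Basis) blast
  moreover have "f \<in> N"
    unfolding N_def C_def using f KU by auto
  ultimately have "\<forall>\<^sub>F n in sequentially. s n \<in> N"
    by (rule limitinD[OF lim])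
  then show "\<forall>\<^sub>F n in sequentially. f (x n) \<in> K \<longrightarrow> s n (x n) \<in> U"
    by (rule eventually_mono) (use x in \<open>auto simp: N_def C_def\<close>)
qed

theorem theorem7p3:
  fixes X :: "'a topology"
  assumes "compact_space X" and "Hausdorff_space X" and "F_space X"
  shows "\<not> (\<exists>s. convergent_sequence_in (compact_open_topology X X) s \<and> \<not> trivial_sequence s)"
proof -
  have "trivial_sequence s" if conv: "convergent_sequence_in (compact_open_topology X X) s" for s
  proof -
    obtain f where lim: "limitin (compact_open_topology X X) s f sequentially"
      using conv unfolding convergent_sequence_in_def by blast
    have s: "s n \<in> continuous_maps X X" for n
      using conv unfolding convergent_sequence_in_def topspace_compact_open_topology by blast
    have f: "f \<in> continuous_maps X X"
      using limitin_topspace[OF lim] by (simp add: topspace_compact_open_topology)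
    have differ: "\<exists>x\<in>topspace X. s n x \<noteq> f x" if "s n \<noteq> f" for n
      using that s[of n] f unfolding continuous_maps_def by (auto intro: extensionalityI)
    have "\<forall>\<^sub>F n in sequentially. s n = f"
    proof (cases "topspace X = {}")
      case True
      then have "s n = f" for n
        using differ by blast
      then show ?thesis
        by simp
    next
      case False
      then have "\<exists>x\<in>topspace X. s n \<noteq> f \<longrightarrow> s n x \<noteq> f x" for n
        using differ by blast
      then obtain x where x: "\<And>n. x n \<in> topspace X" "\<And>n. s n \<noteq> f \<Longrightarrow> s n (x n) \<noteq> f (x n)"
        by metis
      have maps: "g a \<in> topspace X" if "g \<in> continuous_maps X X" "a \<in> topspace X" for g a
        using that by (auto simp: continuous_maps_def continuous_map_def)
      have "\<forall>\<^sub>F n in sequentially. f (x n) = s n (x n)"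
        using compact_open_limit_asymptotically_close[OF assms(1) lim, of x] maps f s x(1)
        by (intro compact_F_space_asymptotically_close_eventually_eq[OF assms]) auto
      then show ?thesis
        by (rule eventually_mono) (use x(2) in metis)
    qed
    then show ?thesis
      unfolding trivial_sequence_def by blast
  qed
  then show ?thesis
    by blast
qed

end
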